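(* Let $\sigma\subset\mathbb{C}$ be a nonempty compact spoke set containing $0$, with $\sigma\subseteq\bigcup_{n=1}^N R_{\theta_n}$ for distinct angles $\theta_1,\dots,\theta_N\in[0,2\pi)$. Then for all $f\in BV(\sigma)$, $$\frac{1}{2N+1}\,|\!|\!|f|\!|\!|_{Sp}\ \le\ \|f\|_{BV(\sigma)}\ \le\ 3\,|\!|\!|f|\!|\!|_{Sp}.$$
   Context: For $0\le\theta<2\pi$, $R_\theta=\{re^{i\theta} : r\ge 0\}\subset\mathbb{C}$. A set $\sigma\subseteq\mathbb{C}$ is a spoke set if it is a subset of a finite union of such rays. Definition of $BV(\sigma)$. Let $\sigma\subset\mathbb{C}$ be nonempty and compact. For a piecewise linear curve $\gamma:[0,1]\to\mathbb{C}$ (continuous, and affine on each interval of some finite partition of $[0,1]$) and a (real) line $\ell$ in the plane, an entry point of $\gamma$ on $\ell$ is a parameter $t\in[0,1]$ with $\gamma(t)\in\ell$ such that either $t=0$, or for every $\epsilon>0$ there is $s\in(t-\epsilon,t)\cap[0,1]$ with $\gamma(s)\notin\ell$. The variation factor $\operatorname{vf}(\gamma)$ is the maximum over all lines $\ell$ of the number of entry points of $\gamma$ on $\ell$, and $\rho(\gamma)=1/\operatorname{vf}(\gamma)$. For $f:\sigma\to\mathbb{C}$, $\operatorname{cvar}(f,\gamma)$ is the supremum of $\sum_{i=1}^{k-1}|f(\gamma(s_{i+1}))-f(\gamma(s_i))|$ over all finite lists $0\le s_1<\dots<s_k\le 1$ with all $\gamma(s_i)\in\sigma$ (zero if there are none).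 Set $\operatorname{var}(f,\sigma)=\sup_\gamma \operatorname{cvar}(f,\gamma)\rho(\gamma)$, the supremum being over all piecewise linear curves, and $\|f\|_{BV(\sigma)}=\sup_\sigma|f|+\operatorname{var}(f,\sigma)$. $BV(\sigma)$ is the Banach algebra of functions with $\|f\|_{BV(\sigma)}<\infty$. Spoke norm. For $n=1,\dots,N$ let $\sigma_n=\sigma\cap R_{\theta_n}$. For $f\in BV(\sigma)$ and $1\le n\le N$ define $f_n:\sigma\to\mathbb{C}$ by $f_n(z)=f(z)-f(0)$ if $z\in R_{\theta_n}$ and $f_n(z)=0$ otherwise. Then $$|\!|\!|f|\!|\!|_{Sp}=|f(0)|+\sum_{n=1}^N\|f_n|_{\sigma_n}\|_{BV(\sigma_n)}.$$ *)

theory Defs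
  imports "HOL-Analysis.Analysis"
begin

definition ray :: "real \<Rightarrow> complex set" where
  "ray \<theta> = {rcis r \<theta> | r. 0 \<le> r}"

definition spoke_set :: "complex set \<Rightarrow> bool" where
  "spoke_set \<sigma> \<longleftrightarrow> (\<exists>\<Theta>. finite \<Theta> \<and> \<Theta> \<subseteq> {0..<2 * pi} \<and> \<sigma> \<subseteq> (\<Union>\<theta>\<in>\<Theta>. ray \<theta>))"

text \<open>Curves are total functions of which only the values on \<open>{0..1}\<close> are ever used.\<close>

definition pl_curve :: "(real \<Rightarrow> complex) \<Rightarrow> bool" where
  "pl_curve \<gamma> \<longleftrightarrow> path \<gamma> \<and>
     (\<exists>(m::nat) p. p 0 = 0 \<and> p m = 1 \<and> (\<forall>i<m. p i < p (Suc i)) \<and>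
        (\<forall>i<m. \<exists>a b. \<forall>t\<in>{p i..p (Suc i)}. \<gamma> t = a + of_real t * b))"

definition lines :: "complex set set" where
  "lines = {affine hull {a, b} | a b. a \<noteq> b}"

definition entry_points :: "(real \<Rightarrow> complex) \<Rightarrow> complex set \<Rightarrow> real set" where
  "entry_points \<gamma> l =
     {t \<in> {0..1}. \<gamma> t \<in> l \<and> (t = 0 \<or> (\<forall>\<epsilon>>0. \<exists>s\<in>{t - \<epsilon><..<t} \<inter> {0..1}. \<gamma> s \<notin> l))}"

text \<open>For a piecewise linear curve with \<open>m\<close> affine pieces every line has at most \<open>m + 1\<close> entry
  points (a piece contributes at most one after its left end, and none if it lies in the line), so
  \<open>card\<close> and \<open>Max\<close> are applied to finite sets. A line through \<open>\<gamma> 0\<close> has an entry point,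
  so \<open>vf \<gamma> \<ge> 1\<close>.\<close>

definition vf :: "(real \<Rightarrow> complex) \<Rightarrow> nat" where
  "vf \<gamma> = Max ((\<lambda>l. card (entry_points \<gamma> l)) ` lines)"

definition rho :: "(real \<Rightarrow> complex) \<Rightarrow> real" where
  "rho \<gamma> = 1 / real (vf \<gamma>)"

text \<open>Variations and norms are \<open>ennreal\<close>-valued, so the suprema always exist and finiteness is what
  membership in \<open>BV \<sigma>\<close> says. A function on \<open>\<sigma>\<close> is a total function of which only the values
  on \<open>\<sigma>\<close> are used. The list of sample parameters may be empty, contributing \<open>0\<close>.\<close>

definition cvar :: "complex set \<Rightarrow> (complex \<Rightarrow> complex) \<Rightarrow> (real \<Rightarrow> complex) \<Rightarrow> ennreal" where
  "cvar \<sigma> f \<gamma> =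
     (SUP s \<in> {s :: real list. sorted_wrt (<) s \<and> set s \<subseteq> {0..1} \<and> \<gamma> ` set s \<subseteq> \<sigma>}.
        ennreal (\<Sum>i<length s - 1. cmod (f (\<gamma> (s ! Suc i)) - f (\<gamma> (s ! i)))))"

definition var :: "complex set \<Rightarrow> (complex \<Rightarrow> complex) \<Rightarrow> ennreal" where
  "var \<sigma> f = (SUP \<gamma> \<in> {\<gamma>. pl_curve \<gamma>}. cvar \<sigma> f \<gamma> * ennreal (rho \<gamma>))"

definition bv_norm :: "complex set \<Rightarrow> (complex \<Rightarrow> complex) \<Rightarrow> ennreal" where
  "bv_norm \<sigma> f = (SUP z\<in>\<sigma>. ennreal (cmod (f z))) + var \<sigma> f"

definition BV :: "complex set \<Rightarrow> (complex \<Rightarrow> complex) set" where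
  "BV \<sigma> = {f. bv_norm \<sigma> f < \<infinity>}"

definition spoke_part :: "real \<Rightarrow> (complex \<Rightarrow> complex) \<Rightarrow> complex \<Rightarrow> complex" where
  "spoke_part \<theta> f z = (if z \<in> ray \<theta> then f z - f 0 else 0)"

definition spoke_norm ::
  "nat \<Rightarrow> (nat \<Rightarrow> real) \<Rightarrow> complex set \<Rightarrow> (complex \<Rightarrow> complex) \<Rightarrow> ennreal" where
  "spoke_norm N \<theta> \<sigma> f =
     ennreal (cmod (f 0)) + (\<Sum>n=1..N. bv_norm (\<sigma> \<inter> ray (\<theta> n)) (spoke_part (\<theta> n) f))"

end

theory Submission imports Defs begin

text \<open>Write \<open>f = f 0 + (\<Sum>n. f\<^sub>n)\<close> on \<open>\<sigma>\<close>. The upper bound reduces to a single spoke: along a curve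
  \<open>\<gamma>\<close>, every sum of increments of \<open>f\<^sub>n\<close> is at most \<open>vf \<gamma> * (var f\<^sub>n + 2 * sup \<bar>f\<^sub>n\<bar>)\<close>. Let \<open>L\<close> be the
  full line through the spoke. Steps into or out of \<open>L\<close> cost at most \<open>sup \<bar>f\<^sub>n\<bar>\<close> each, and there are at
  most \<open>2 * vf \<gamma>\<close> of them by counting entry points on \<open>L\<close>. Steps inside \<open>L\<close> (where \<open>f\<^sub>n\<close> vanishes on
  the opposite ray) cover each point of the spoke at most \<open>vf \<gamma>\<close> times, by counting entry points on
  the perpendicular to \<open>L\<close> at that point. The lower bound is the triangle inequality.\<close>

section \<open>Lines in the plane\<close>

lemma affine_lines: "l \<in> lines \<Longrightarrow> affine l"
  by (auto simp: lines_def)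

lemma closed_lines: "l \<in> lines \<Longrightarrow> closed l"
  by (auto simp: lines_def closed_affine_hull)

text \<open>Multiplication by \<open>\<i>\<close> is a quarter turn, so \<open>d\<close> and
  \<open>\<i> * d\<close> are an orthonormal basis of the plane over the reals.\<close>

lemma complex_orthonormal_expansion:
  assumes "cmod d = 1"
  shows "z = (d \<bullet> z) *\<^sub>R d + ((\<i> * d) \<bullet> z) *\<^sub>R (\<i> * d)"
proof -
  have "(Re d)\<^sup>2 + (Im d)\<^sup>2 = 1"
    using assms by (metis cmod_power2 one_power2)
  then show ?thesis
    by (auto simp: complex_eq_iff inner_complex_def power2_eq_square) algebra+
qed

text \<open>Passes from a unit normal to the two-point form of \<open>lines\<close>: the line runs
  through \<open>c *\<^sub>R d\<close> in direction \<open>\<i> * d\<close>.\<close>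

lemma hyperplane_mem_lines:
  assumes "cmod d = 1"
  shows "{z. d \<bullet> z = c} \<in> lines"
proof -
  have dd: "d \<bullet> d = 1" using assms by (simp add: dot_square_norm)
  have di: "d \<bullet> (\<i> * d) = 0" by (simp add: inner_complex_def)
  have d0: "d \<noteq> 0" using assms by auto
  have "{z. d \<bullet> z = c} = affine hull {c *\<^sub>R d, c *\<^sub>R d + \<i> * d}"
  proof (intro subset_antisym subsetI)
    fix z assume "z \<in> {z. d \<bullet> z = c}"
    then have z: "z = c *\<^sub>R d + ((\<i> * d) \<bullet> z) *\<^sub>R (\<i> * d)"
      using complex_orthonormal_expansion[OF assms, of z] by simp
    define v where "v = (\<i> * d) \<bullet> z"
    have "z = (1 - v) *\<^sub>R (c *\<^sub>R d) + v *\<^sub>R (c *\<^sub>R d + \<i> * d)"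
      using z unfolding v_def[symmetric] by (simp add: algebra_simps)
    moreover have "(1 - v) + v = 1" by simp
    ultimately show "z \<in> affine hull {c *\<^sub>R d, c *\<^sub>R d + \<i> * d}"
      unfolding affine_hull_2 by blast
  next
    fix z assume "z \<in> affine hull {c *\<^sub>R d, c *\<^sub>R d + \<i> * d}"
    then obtain u v where "z = u *\<^sub>R (c *\<^sub>R d) + v *\<^sub>R (c *\<^sub>R d + \<i> * d)" "u + v = 1"
      unfolding affine_hull_2 by auto
    then show "z \<in> {z. d \<bullet> z = c}"
      by (simp add: inner_add_right dd di flip: distrib_right)
  qed
  moreover have "c *\<^sub>R d \<noteq> c *\<^sub>R d + \<i> * d" using d0 by simp
  ultimately show ?thesis unfolding lines_def by blast
qed

section \<open>Entry points of piecewise linear curves and the variation factor\<close>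

text \<open>Two entry points on one affine piece would put the whole stretch between them into
  \<open>l\<close>, but the later one needs points off \<open>l\<close> immediately before
  it.\<close>

lemma card_entry_points_affine_piece:
  assumes "affine l" and \<gamma>: "\<And>t. t \<in> {u..v} \<Longrightarrow> \<gamma> t = a + of_real t * b"
  shows "finite (entry_points \<gamma> l \<inter> {u..v}) \<and> card (entry_points \<gamma> l \<inter> {u..v}) \<le> 1"
proof -
  have False if e: "e \<in> entry_points \<gamma> l" "e \<in> {u..v}"
    and e': "e' \<in> entry_points \<gamma> l" "e' \<in> {u..v}" and "e < e'" for e e'
  proof -
    \<comment> \<open>Taking \<open>\<epsilon> = e' - e\<close> places the point off
      \<open>l\<close> strictly between \<open>e\<close> and \<open>e'\<close>.\<close>
    have "e' \<noteq> 0" "e' - e > 0" using e \<open>e < e'\<close> by (auto simp: entry_points_def)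
    then have "\<exists>s\<in>{e' - (e' - e)<..<e'} \<inter> {0..1}. \<gamma> s \<notin> l"
      using e'(1) unfolding entry_points_def by blast
    then obtain s where s: "e < s" "s < e'" "\<gamma> s \<notin> l" by auto
    define w where "w = (s - e) / (e' - e)"
    have "w * (e' - e) = s - e" using \<open>e < e'\<close> by (simp add: w_def)
    then have w: "s = (1 - w) * e + w * e'" by (simp add: algebra_simps)
    have "\<gamma> s = a + of_real ((1 - w) * e + w * e') * b"
      using \<gamma>[of s] s e(2) e'(2) w by auto
    also have "\<dots> = (1 - w) *\<^sub>R \<gamma> e + w *\<^sub>R \<gamma> e'"
      unfolding \<gamma>[OF e(2)] \<gamma>[OF e'(2)] by (simp add: scaleR_conv_of_real algebra_simps)
    also have "\<dots> \<in> l"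
      using e(1) e'(1) \<open>affine l\<close> by (intro mem_affine) (auto simp: entry_points_def)
    finally show False using s by simp
  qed
  then have "e = e'" if "e \<in> entry_points \<gamma> l \<inter> {u..v}" "e' \<in> entry_points \<gamma> l \<inter> {u..v}" for e e'
    using that by (meson IntE linorder_less_linear)
  then have "entry_points \<gamma> l \<inter> {u..v} = {} \<or> (\<exists>e. entry_points \<gamma> l \<inter> {u..v} = {e})" by blast
  then show ?thesis by force
qed

lemma partition_covers:
  fixes p :: "nat \<Rightarrow> real"
  assumes "p 0 \<le> t" "t \<le> p m" "0 < m"
  shows "\<exists>i<m. t \<in> {p i..p (Suc i)}"
  using assms(2,3)
proof (induction m)
  case (Suc m)
  show ?case
  proof (cases "t \<le> p m \<and> 0 < m")
    case True
    then show ?thesis using Suc.IH less_Suc_eq by blast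
  next
    case False
    then have "t \<in> {p m..p (Suc m)}" using Suc.prems assms(1) by auto
    then show ?thesis by blast
  qed
qed simp

text \<open>The number of affine pieces serves as \<open>K\<close> for all lines at once. This
  uniformity makes the \<open>Max\<close> in \<open>vf\<close> range over a finite set.\<close>

lemma entry_points_bounded:
  assumes "pl_curve \<gamma>"
  shows "\<exists>K. \<forall>l\<in>lines. finite (entry_points \<gamma> l) \<and> card (entry_points \<gamma> l) \<le> K"
proof -
  from assms obtain m :: nat and p where p: "p 0 = 0" "p m = 1"
    and pieces: "\<And>i. i < m \<Longrightarrow> \<exists>a b. \<forall>t\<in>{p i..p (Suc i)}. \<gamma> t = a + of_real t * b"
    unfolding pl_curve_def by blast
  have "0 < m" using p by (cases m) auto
  have "finite (entry_points \<gamma> l) \<and> card (entry_points \<gamma> l) \<le> m" if "l \<in> lines" for l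
  proof -
    let ?E = "\<lambda>i. entry_points \<gamma> l \<inter> {p i..p (Suc i)}"
    have E: "finite (?E i) \<and> card (?E i) \<le> 1" if i: "i < m" for i
    proof -
      obtain a b where "\<And>t. t \<in> {p i..p (Suc i)} \<Longrightarrow> \<gamma> t = a + of_real t * b"
        using pieces[OF i] by blast
      then show ?thesis
        by (rule card_entry_points_affine_piece[OF affine_lines[OF \<open>l \<in> lines\<close>]])
    qed
    have eq: "entry_points \<gamma> l = (\<Union>i<m. ?E i)"
    proof -
      have "\<exists>i<m. t \<in> {p i..p (Suc i)}" if "t \<in> entry_points \<gamma> l" for t
        using that p \<open>0 < m\<close> by (intro partition_covers) (auto simp: entry_points_def)
      then show ?thesis by blast
    qed
    have "card (\<Union>i<m. ?E i) \<le> (\<Sum>i<m. card (?E i))" by (rule card_UN_le) simp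
    also have "\<dots> \<le> (\<Sum>i<m. 1)" by (rule sum_mono) (use E in blast)
    finally have "card (entry_points \<gamma> l) \<le> m" using eq by simp
    moreover have "finite (\<Union>i<m. ?E i)" using E by blast
    ultimately show ?thesis using eq by simp
  qed
  then show ?thesis by blast
qed

lemma finite_entry_points:
  "pl_curve \<gamma> \<Longrightarrow> l \<in> lines \<Longrightarrow> finite (entry_points \<gamma> l)"
  using entry_points_bounded by blast

lemma card_entry_points_le_vf:
  assumes "pl_curve \<gamma>" "l \<in> lines"
  shows "card (entry_points \<gamma> l) \<le> vf \<gamma>"
proof -
  obtain K where "\<forall>l\<in>lines. card (entry_points \<gamma> l) \<le> K"
    using entry_points_bounded[OF assms(1)] by blast
  then have "(\<lambda>l. card (entry_points \<gamma> l)) ` lines \<subseteq> {..K}" by auto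
  then show ?thesis
    unfolding vf_def using assms(2) by (intro Max_ge) (auto intro: finite_subset)
qed

lemma pl_curve_segment: "pl_curve (\<lambda>t. of_real t * b)"
  unfolding pl_curve_def path_def
proof (intro conjI exI[of _ "1::nat"] exI[of _ real] allI impI)
  fix i :: nat
  show "\<exists>a c. \<forall>t\<in>{real i..real (Suc i)}. complex_of_real t * b = a + complex_of_real t * c"
    by (rule exI[of _ 0]) auto
qed (auto intro!: continuous_intros)

text \<open>There is a single affine piece, hence at most one entry point per line, and the
  imaginary axis has one at time 0. Segments from the origin therefore enter \<open>var\<close> with
  weight 1.\<close>

lemma vf_segment: "vf (\<lambda>t. of_real t * b) = 1"
proof -
  let ?\<gamma> = "\<lambda>t. of_real t * b"
  let ?c = "\<lambda>l. card (entry_points ?\<gamma> l)"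
  have le: "?c l \<le> 1" if "l \<in> lines" for l
  proof -
    have "entry_points ?\<gamma> l \<inter> {0..1} = entry_points ?\<gamma> l" by (auto simp: entry_points_def)
    then show ?thesis
      using card_entry_points_affine_piece[OF affine_lines[OF that], of 0 1 ?\<gamma> 0 b] by simp
  qed
  have l0: "{z. 1 \<bullet> z = (0::real)} \<in> lines" by (rule hyperplane_mem_lines) simp
  have "0 \<in> entry_points ?\<gamma> {z. 1 \<bullet> z = (0::real)}" by (simp add: entry_points_def)
  then have "?c {z. 1 \<bullet> z = (0::real)} \<noteq> 0"
    using finite_entry_points[OF pl_curve_segment l0] by auto
  then have "vf ?\<gamma> \<ge> 1" using card_entry_points_le_vf[OF pl_curve_segment l0, of b] by linarith
  moreover have "vf ?\<gamma> \<le> 1"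
    unfolding vf_def
  proof (rule Max.boundedI)
    have "?c ` lines \<subseteq> {..1}" using le by auto
    then show "finite (?c ` lines)" by (rule finite_subset) simp
    show "?c ` lines \<noteq> {}" using l0 by blast
  qed (use le in auto)
  ultimately show ?thesis by simp
qed

section \<open>Entry points forced by hitting or crossing a line\<close>

text \<open>The first time after \<open>s\<close> at which the curve meets \<open>l\<close> exists
  by compactness, and it is an entry point because the curve is off \<open>l\<close> from
  \<open>s\<close> up to it.\<close>

lemma entry_point_between:
  assumes "path \<gamma>" "closed l" "0 \<le> s" "s \<le> t" "t \<le> 1" "\<gamma> s \<notin> l" "\<gamma> t \<in> l"
  shows "\<exists>e\<in>entry_points \<gamma> l. s < e \<and> e \<le> t"
proof -
  define A where "A = {s..t} \<inter> \<gamma> -` l"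
  have "continuous_on {s..t} \<gamma>"
    by (rule continuous_on_subset[OF assms(1)[unfolded path_def]]) (use assms in auto)
  then have "closed A" unfolding A_def using assms(2) by (intro continuous_closed_preimage) auto
  moreover have "bounded A" unfolding A_def using bounded_subset[OF bounded_closed_interval] by blast
  ultimately have cpt: "compact A" by (simp add: compact_eq_bounded_closed)
  have ne: "A \<noteq> {}" using assms by (auto simp: A_def)
  obtain e where e: "e \<in> A" and inf: "\<And>u. u \<in> A \<Longrightarrow> e \<le> u"
    using compact_attains_inf[OF cpt ne] by auto
  have "s < e" using e assms by (cases "s = e") (auto simp: A_def)
  have "\<exists>u\<in>{e - \<epsilon><..<e} \<inter> {0..1}. \<gamma> u \<notin> l" if "0 < \<epsilon>" for \<epsilon>
  proof (rule bexI)
    \<comment> \<open>Halving \<open>\<epsilon>\<close> keeps \<open>?u\<close> inside the open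
      interval; the maximum with \<open>s\<close> keeps it in the range where minimality of
      \<open>e\<close> applies.\<close>
    let ?u = "max s (e - \<epsilon> / 2)"
    have "?u \<notin> A" using inf[of ?u] \<open>s < e\<close> that by auto
    then show "\<gamma> ?u \<notin> l" using e \<open>s < e\<close> that by (auto simp: A_def)
    show "?u \<in> {e - \<epsilon><..<e} \<inter> {0..1}" using e \<open>s < e\<close> that assms by (auto simp: A_def)
  qed
  then have "e \<in> entry_points \<gamma> l" using e assms by (auto simp: A_def entry_points_def)
  then show ?thesis using e \<open>s < e\<close> by (auto simp: A_def)
qed

text \<open>If the curve starts on \<open>l\<close>, the clause \<open>t = 0\<close> of
  \<open>entry_points\<close> supplies the point; otherwise a first hitting time does.\<close>

lemma entry_point_before:
  assumes "path \<gamma>" "closed l" "0 \<le> t" "t \<le> 1" "\<gamma> t \<in> l"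
  shows "\<exists>e\<in>entry_points \<gamma> l. e \<le> t"
proof (cases "\<gamma> 0 \<in> l")
  case True
  then have "0 \<in> entry_points \<gamma> l" by (auto simp: entry_points_def)
  then show ?thesis using assms by blast
next
  case False
  then show ?thesis using entry_point_between[OF assms(1,2), of 0 t] assms by auto
qed

text \<open>The intermediate value theorem gives a hit of the level line. Strictness of the
  inequalities keeps \<open>\<gamma> s\<close> off that line, so the resulting entry point comes
  strictly after \<open>s\<close>.\<close>

lemma entry_point_hyperplane_between:
  assumes "path \<gamma>" "cmod d = 1" "0 \<le> s" "s \<le> t" "t \<le> 1"
    and "min (d \<bullet> \<gamma> s) (d \<bullet> \<gamma> t) < y" "y < max (d \<bullet> \<gamma> s) (d \<bullet> \<gamma> t)"
  shows "\<exists>e\<in>entry_points \<gamma> {z. d \<bullet> z = y}. s < e \<and> e \<le> t"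
proof -
  have "continuous_on {s..t} \<gamma>"
    by (rule continuous_on_subset[OF assms(1)[unfolded path_def]]) (use assms in auto)
  then have cont: "continuous_on {s..t} (\<lambda>u. d \<bullet> \<gamma> u)" by (intro continuous_intros)
  have "\<exists>u. s \<le> u \<and> u \<le> t \<and> d \<bullet> \<gamma> u = y"
  proof (cases "d \<bullet> \<gamma> s \<le> d \<bullet> \<gamma> t")
    case True
    then show ?thesis using assms cont by (intro IVT') auto
  next
    case False
    then show ?thesis using assms cont by (intro IVT2') auto
  qed
  then obtain u where u: "s \<le> u" "u \<le> t" "d \<bullet> \<gamma> u = y" by blast
  have "\<exists>e\<in>entry_points \<gamma> {z. d \<bullet> z = y}. s < e \<and> e \<le> u"
    using assms u by (intro entry_point_between closed_lines hyperplane_mem_lines) auto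
  then show ?thesis using u by force
qed

section \<open>Counting transitions by entry points\<close>

text \<open>The half-open intervals between consecutive samples are disjoint, so the chosen entry
  points are distinct. Restricting to those after \<open>s ! 0\<close> leaves the earlier ones free
  to pay for a run that begins with the first sample.\<close>

lemma card_steps_le_card_between:
  fixes s :: "real list"
  assumes "finite E" "sorted_wrt (<) s" "J \<subseteq> {..<length s - 1}"
    and "\<And>i. i \<in> J \<Longrightarrow> \<exists>e\<in>E. s ! i < e \<and> e \<le> s ! Suc i"
  shows "card J \<le> card {e \<in> E. s ! 0 < e}"
proof -
  obtain e where e: "\<And>i. i \<in> J \<Longrightarrow> e i \<in> E \<and> s ! i < e i \<and> e i \<le> s ! Suc i"
    using assms(4) by metis
  have mono: "s ! i \<le> s ! j" if "i \<le> j" "j < length s" for i j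
    using sorted_wrt_nth_less[OF assms(2), of i j] that by (cases "i = j") auto
  have lt: "e i < e j" if "i \<in> J" "j \<in> J" "i < j" for i j
  proof -
    have "s ! Suc i \<le> s ! j" using that assms(3) by (intro mono) auto
    then show ?thesis using e[OF that(1)] e[OF that(2)] by linarith
  qed
  then have "inj_on e J" by (metis inj_onI less_irrefl nat_neq_iff)
  moreover have "e ` J \<subseteq> {e \<in> E. s ! 0 < e}"
  proof (intro image_subsetI CollectI conjI)
    fix i assume "i \<in> J"
    then have "s ! 0 \<le> s ! i" using assms(3) by (intro mono) auto
    then show "s ! 0 < e i" using e[OF \<open>i \<in> J\<close>] by linarith
  qed (use e in blast)
  ultimately show ?thesis using assms(1) by (intro card_inj_on_le) auto
qed

text \<open>Exits and entries alternate, and an exit without a preceding entry requires starting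
  inside.\<close>

lemma card_exits_le_card_entries:
  "card {i. i < k \<and> P i \<and> \<not> P (Suc i)} \<le> card {i. i < k \<and> \<not> P i \<and> P (Suc i)} + of_bool (P 0)"
proof -
  \<comment> \<open>The induction runs on an exact balance, in which \<open>of_bool (P k)\<close>
    records whether the walk ends inside.\<close>
  have "card {i. i < k \<and> P i \<and> \<not> P (Suc i)} + of_bool (P k) =
    card {i. i < k \<and> \<not> P i \<and> P (Suc i)} + of_bool (P 0)"
  proof (induction k)
    case (Suc k)
    have step: "{i. i < Suc k \<and> Q i} = (if Q k then insert k {i. i < k \<and> Q i} else {i. i < k \<and> Q i})"
      for Q :: "nat \<Rightarrow> bool" by (auto simp: less_Suc_eq)
    show ?case using Suc.IH unfolding step by (auto split: if_splits)
  qed simp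
  then show ?thesis by linarith
qed

text \<open>Both crossings of a line, in and out, are paid for by entry points: every maximal run of
  samples on the line begins at or after a new one.\<close>

lemma card_line_transitions_le:
  assumes "pl_curve \<gamma>" "l \<in> lines" "sorted_wrt (<) s" "set s \<subseteq> {0..1}"
  shows "card {i. i < length s - 1 \<and> (\<gamma> (s ! i) \<in> l) \<noteq> (\<gamma> (s ! Suc i) \<in> l)} \<le> 2 * vf \<gamma>"
proof (cases "s = []")
  case False
  let ?k = "length s - 1" and ?P = "\<lambda>i. \<gamma> (s ! i) \<in> l" and ?E = "entry_points \<gamma> l"
  let ?in = "{i. i < ?k \<and> \<not> ?P i \<and> ?P (Suc i)}" and ?out = "{i. i < ?k \<and> ?P i \<and> \<not> ?P (Suc i)}"
  note fin = finite_entry_points[OF assms(1,2)] and cl = closed_lines[OF assms(2)]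
  have path: "path \<gamma>" using assms(1) by (simp add: pl_curve_def)
  have s01: "0 \<le> s ! i \<and> s ! i \<le> 1" if "i < length s" for i
    using subsetD[OF assms(4) nth_mem[OF that]] by simp
  have "\<exists>e\<in>?E. s ! i < e \<and> e \<le> s ! Suc i" if "i \<in> ?in" for i
  proof -
    have i: "i < length s" "Suc i < length s" using that by auto
    have "s ! i < s ! Suc i" using i by (intro sorted_wrt_nth_less[OF assms(3)]) auto
    then show ?thesis
      using that s01[OF i(1)] s01[OF i(2)] by (intro entry_point_between[OF path cl]) auto
  qed
  then have in_le: "card ?in \<le> card {e \<in> ?E. s ! 0 < e}"
    by (intro card_steps_le_card_between[OF fin assms(3)]) auto
  \<comment> \<open>A run that begins with the first sample has no entering step; an entry point at
    or before \<open>s ! 0\<close> pays for it, and none of those counted for \<open>?in\<close>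
    lies there.\<close>
  have "of_bool (?P 0) \<le> card {e \<in> ?E. e \<le> s ! 0}"
  proof (cases "?P 0")
    case True
    then have "{e \<in> ?E. e \<le> s ! 0} \<noteq> {}"
      using entry_point_before[OF path cl, of "s ! 0"] s01[of 0] False by auto
    then have "card {e \<in> ?E. e \<le> s ! 0} \<noteq> 0" using fin by auto
    then show ?thesis by simp
  qed simp
  with in_le have "card ?in + of_bool (?P 0) \<le> card {e \<in> ?E. s ! 0 < e} + card {e \<in> ?E. e \<le> s ! 0}"
    by linarith
  also have "\<dots> = card ({e \<in> ?E. s ! 0 < e} \<union> {e \<in> ?E. e \<le> s ! 0})"
    using fin by (intro card_Un_disjoint[symmetric]) auto
  also have "\<dots> \<le> card ?E" using fin by (intro card_mono) auto
  also have "\<dots> \<le> vf \<gamma>" by (rule card_entry_points_le_vf[OF assms(1,2)])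
  finally have "card ?in + of_bool (?P 0) \<le> vf \<gamma>" .
  moreover have "card ?out \<le> card ?in + of_bool (?P 0)" by (rule card_exits_le_card_entries)
  moreover have "card {i. i < ?k \<and> ?P i \<noteq> ?P (Suc i)} = card (?in \<union> ?out)"
    by (rule arg_cong[of _ _ card]) blast
  moreover have "card (?in \<union> ?out) \<le> card ?in + card ?out" by (rule card_Un_le)
  ultimately show ?thesis by linarith
qed simp

section \<open>Variation along a line and along a ray\<close>

text \<open>Telescoping; \<open>min\<close> and \<open>max\<close> allow a step of a walk to go in
  either direction.\<close>

lemma norm_diff_le_sum_steps:
  fixes h :: "nat \<Rightarrow> 'a::real_normed_vector"
  shows "norm (h a - h b) \<le> (\<Sum>j\<in>{min a b..<max a b}. norm (h (Suc j) - h j))"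
proof -
  have le: "norm (h b - h a) \<le> (\<Sum>j\<in>{a..<b}. norm (h (Suc j) - h j))" if "a \<le> b" for a b
    using norm_sum[of "\<lambda>j. h (Suc j) - h j" "{a..<b}"] that by (simp add: sum_Suc_diff')
  show ?thesis using le[of a b] le[of b a] by (cases "a \<le> b") (auto simp: norm_minus_commute)
qed

text \<open>Banach indicatrix: a walk on the line is charged to the gaps of the sorted list \<open>xs\<close> of
  visited points, and the number of steps crossing a gap is the number crossing its midpoint.\<close>

lemma sum_steps_le_mult_variation:
  fixes h :: "real \<Rightarrow> 'a::real_normed_vector" and x x' :: "'i \<Rightarrow> real"
  assumes "finite I" "sorted_wrt (<) xs" "x ` I \<union> x' ` I \<subseteq> set xs"
    and M: "\<And>y. card {i \<in> I. min (x i) (x' i) < y \<and> y < max (x i) (x' i)} \<le> M"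
  shows "(\<Sum>i\<in>I. norm (h (x' i) - h (x i)))
    \<le> real M * (\<Sum>j<length xs - 1. norm (h (xs ! Suc j) - h (xs ! j)))"
proof -
  let ?m = "length xs - 1" and ?D = "\<lambda>j. norm (h (xs ! Suc j) - h (xs ! j))"
  let ?y = "\<lambda>j. (xs ! j + xs ! Suc j) / 2"
  let ?C = "\<lambda>i y. min (x i) (x' i) < y \<and> y < max (x i) (x' i)"
  have mono: "xs ! i \<le> xs ! j" if "i \<le> j" "j < length xs" for i j
    using sorted_wrt_nth_less[OF assms(2), of i j] that by (cases "i = j") auto
  have step: "norm (h (x' i) - h (x i)) \<le> (\<Sum>j<?m. if ?C i (?y j) then ?D j else 0)"
    if "i \<in> I" for i
  proof -
    obtain a b where a: "a < length xs" "x i = xs ! a" and b: "b < length xs" "x' i = xs ! b"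
      using assms(3) \<open>i \<in> I\<close> by (metis UnCI image_eqI in_set_conv_nth subsetD)
    have C: "?C i (?y j)" if "j \<in> {min a b..<max a b}" for j
    proof -
      have "xs ! j < xs ! Suc j"
        using a b that by (intro sorted_wrt_nth_less[OF assms(2)]) auto
      moreover have "xs ! min a b \<le> xs ! j" "xs ! Suc j \<le> xs ! max a b"
        using a b that by (auto intro!: mono)
      moreover have "min (x i) (x' i) \<le> xs ! min a b" "xs ! max a b \<le> max (x i) (x' i)"
        using a b by (auto simp: min_def max_def)
      ultimately show ?thesis by (auto simp del: min_less_iff_disj less_max_iff_disj)
    qed
    have "norm (h (x' i) - h (x i)) \<le> (\<Sum>j\<in>{min a b..<max a b}. ?D j)"
      using norm_diff_le_sum_steps[of "\<lambda>j. h (xs ! j)" b a] a b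
      by (simp add: min.commute max.commute)
    also have "\<dots> = (\<Sum>j\<in>{min a b..<max a b}. if ?C i (?y j) then ?D j else 0)"
      using C by (intro sum.cong) auto
    also have "\<dots> \<le> (\<Sum>j<?m. if ?C i (?y j) then ?D j else 0)"
      using a b by (intro sum_mono2) auto
    finally show ?thesis .
  qed
  have "(\<Sum>i\<in>I. norm (h (x' i) - h (x i))) \<le> (\<Sum>i\<in>I. \<Sum>j<?m. if ?C i (?y j) then ?D j else 0)"
    by (rule sum_mono) (rule step)
  \<comment> \<open>After the exchange each gap is weighted by the number of steps over its
    midpoint, which \<open>M\<close> bounds.\<close>
  also have "\<dots> = (\<Sum>j<?m. \<Sum>i\<in>I. if ?C i (?y j) then ?D j else 0)"
    by (rule sum.swap)
  also have "\<dots> = (\<Sum>j<?m. real (card {i \<in> I. ?C i (?y j)}) * ?D j)"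
    using assms(1) by (intro sum.cong refl) (simp only: sum.inter_filter[symmetric] sum_constant)
  also have "\<dots> \<le> (\<Sum>j<?m. real M * ?D j)"
    by (intro sum_mono mult_right_mono of_nat_mono M norm_ge_zero)
  also have "\<dots> = real M * (\<Sum>j<?m. ?D j)" by (simp add: sum_distrib_left)
  finally show ?thesis .
qed

text \<open>A segment from the origin visits the points in increasing order and has variation factor
  1, so no constant is lost.\<close>

lemma variation_on_ray_le_var:
  assumes "sorted_wrt (<) xs" "\<And>x. x \<in> set xs \<Longrightarrow> 0 \<le> x \<and> rcis x \<theta> \<in> \<tau>"
  shows "ennreal (\<Sum>j<length xs - 1. cmod (g (rcis (xs ! Suc j) \<theta>) - g (rcis (xs ! j) \<theta>))) \<le> var \<tau> g"
    (is "ennreal ?v \<le> _")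
proof -
  \<comment> \<open>Inserting 1 into the maximum makes \<open>R\<close> positive even if
    \<open>xs\<close> is empty or contains only 0, so that division by \<open>R\<close> rescales
    into the unit interval.\<close>
  obtain R where R: "R > 0" "\<And>x. x \<in> set xs \<Longrightarrow> x \<le> R"
  proof
    have "1 \<le> Max (insert 1 (set xs))" by (rule Max_ge) auto
    then show "Max (insert 1 (set xs)) > 0" by linarith
  qed simp
  define \<gamma> where "\<gamma> = (\<lambda>t. of_real t * rcis R \<theta>)"
  have \<gamma>: "\<gamma> (x / R) = rcis x \<theta>" for x
    using R(1) by (simp add: \<gamma>_def rcis_def)
  let ?s = "map (\<lambda>x. x / R) xs"
  have s: "sorted_wrt (<) ?s" "set ?s \<subseteq> {0..1}" "\<gamma> ` set ?s \<subseteq> \<tau>"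
    using assms R \<gamma> by (auto simp: sorted_wrt_map divide_less_cancel)
  have "?v = (\<Sum>i<length ?s - 1. cmod (g (\<gamma> (?s ! Suc i)) - g (\<gamma> (?s ! i))))"
    by (intro sum.cong) (auto simp: \<gamma>)
  then have "ennreal ?v \<le> cvar \<tau> g \<gamma>"
    unfolding cvar_def using s by (auto intro!: SUP_upper2[of ?s])
  also have "\<dots> = cvar \<tau> g \<gamma> * ennreal (rho \<gamma>)"
    by (simp add: rho_def \<gamma>_def vf_segment)
  also have "\<dots> \<le> var \<tau> g"
    unfolding var_def by (rule SUP_upper) (simp add: \<gamma>_def pl_curve_segment)
  finally show ?thesis .
qed

section \<open>Rays and their angles\<close>

lemma ray_eq: "ray \<theta> = {r *\<^sub>R cis \<theta> | r. 0 \<le> r}"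
  by (simp add: ray_def rcis_def scaleR_conv_of_real)

lemma zero_mem_ray: "0 \<in> ray \<theta>"
  by (force simp: ray_def)

text \<open>In this range of angles, \<open>Arg2pi\<close> of any nonzero point of a ray recovers
  its angle.\<close>

lemma ray_angle_unique:
  assumes "z \<noteq> 0" "z \<in> ray \<theta>" "z \<in> ray \<phi>" "\<theta> \<in> {0..<2 * pi}" "\<phi> \<in> {0..<2 * pi}"
  shows "\<theta> = \<phi>"
proof -
  have "Arg2pi z = \<alpha>" if z: "z \<in> ray \<alpha>" and \<alpha>: "\<alpha> \<in> {0..<2 * pi}" for \<alpha>
  proof -
    obtain r where "0 \<le> r" "z = rcis r \<alpha>" using z by (auto simp: ray_def)
    then show ?thesis
      using assms(1) \<alpha> by (intro Arg2pi_unique[of r]) (auto simp: rcis_def cis_conv_exp le_less)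
  qed
  then show ?thesis using assms by metis
qed

section \<open>Variation of a function supported on one ray\<close>

text \<open>The factor \<open>vf \<gamma>\<close> in the bound is the one that
  \<open>rho \<gamma>\<close> cancels when the spokes are added up.\<close>

lemma sum_steps_le_vf_mult:
  assumes \<gamma>: "pl_curve \<gamma>" and "0 \<in> \<sigma>" and "g 0 = 0" and g: "\<And>z. z \<notin> ray \<theta> \<Longrightarrow> g z = 0"
    and s: "sorted_wrt (<) s" "set s \<subseteq> {0..1}" "\<gamma> ` set s \<subseteq> \<sigma>"
  shows "ennreal (\<Sum>i<length s - 1. cmod (g (\<gamma> (s ! Suc i)) - g (\<gamma> (s ! i))))
    \<le> of_nat (vf \<gamma>) * (var (\<sigma> \<inter> ray \<theta>) g + 2 * (SUP z\<in>\<sigma> \<inter> ray \<theta>. ennreal (cmod (g z))))"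
    (is "ennreal (\<Sum>i<?k. ?d i) \<le> of_nat (vf \<gamma>) * (?V + 2 * ?S)")
proof -
  define d where "d = cis \<theta>"
  have d: "cmod d = 1" by (simp add: d_def)
  \<comment> \<open>Entry points are counted on full lines only, so the ray is replaced by the line
    containing it, with normal \<open>\<i> * d\<close>.\<close>
  define L where "L = {z. (\<i> * d) \<bullet> z = 0}"
  have L: "L \<in> lines" unfolding L_def using d by (intro hyperplane_mem_lines) (simp add: norm_mult)
  have L_eq: "z = (d \<bullet> z) *\<^sub>R d" if "z \<in> L" for z
    using complex_orthonormal_expansion[OF d, of z] that by (simp add: L_def)
  have ray_L: "z \<in> L" if "z \<in> ray \<theta>" for z
    using that by (auto simp: ray_eq L_def d_def inner_complex_def)
  \<comment> \<open>Clamping folds the opposite ray onto the origin. There \<open>g\<close> has the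
    same value 0, so steps inside \<open>L\<close> become steps on the spoke itself.\<close>
  define q where "q z = max 0 (d \<bullet> z)" for z
  have q: "rcis (q z) \<theta> \<in> \<sigma> \<inter> ray \<theta> \<and> g (rcis (q z) \<theta>) = g z" if "z \<in> L" "z \<in> \<sigma>" for z
  proof (cases "0 \<le> d \<bullet> z")
    case True
    then have "rcis (q z) \<theta> = z"
      using L_eq[OF \<open>z \<in> L\<close>] by (simp add: q_def rcis_def d_def scaleR_conv_of_real)
    moreover have "z \<in> ray \<theta>" using L_eq[OF \<open>z \<in> L\<close>] True unfolding ray_eq d_def by blast
    ultimately show ?thesis using \<open>z \<in> \<sigma>\<close> by simp
  next
    case False
    have "d \<bullet> (r *\<^sub>R d) = r" for r using d by (simp add: dot_square_norm)
    then have "z \<notin> ray \<theta>" using False by (auto simp: ray_eq d_def)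
    then show ?thesis using False g assms(2,3) zero_mem_ray by (simp add: q_def)
  qed
  have path: "path \<gamma>" using \<gamma> by (simp add: pl_curve_def)
  have s01: "0 \<le> s ! i \<and> s ! i \<le> 1" if "i < length s" for i
    using subsetD[OF s(2) nth_mem[OF that]] by simp
  have mem: "\<gamma> (s ! i) \<in> \<sigma>" if "i < length s" for i
    using subsetD[OF s(3) imageI[OF nth_mem[OF that]]] .
  let ?P = "\<lambda>i. \<gamma> (s ! i) \<in> L"
  \<comment> \<open>Steps inside \<open>L\<close> go to \<open>I\<close>, steps into or out of
    \<open>L\<close> to \<open>J\<close>. The remaining steps have both ends off \<open>L\<close>,
    where \<open>g\<close> vanishes.\<close>
  define I where "I = {i. i < ?k \<and> ?P i \<and> ?P (Suc i)}"
  define J where "J = {i. i < ?k \<and> ?P i \<noteq> ?P (Suc i)}"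
  have fin: "finite I" "finite J" by (simp_all add: I_def J_def)
  have "(\<Sum>i<?k. ?d i) = (\<Sum>i\<in>I \<union> J. ?d i)"
  proof (rule sum.mono_neutral_right)
    show "\<forall>i\<in>{..<?k} - (I \<union> J). ?d i = 0"
    proof
      fix i assume "i \<in> {..<?k} - (I \<union> J)"
      then have "\<not> ?P i" "\<not> ?P (Suc i)" by (auto simp: I_def J_def)
      then show "?d i = 0" using ray_L g by (metis diff_zero norm_zero)
    qed
  qed (auto simp: I_def J_def)
  also have "\<dots> = (\<Sum>i\<in>I. ?d i) + (\<Sum>i\<in>J. ?d i)"
    using fin by (intro sum.union_disjoint) (auto simp: I_def J_def)
  finally have split: "ennreal (\<Sum>i<?k. ?d i) = ennreal (\<Sum>i\<in>I. ?d i) + ennreal (\<Sum>i\<in>J. ?d i)"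
    by (simp add: ennreal_plus sum_nonneg)

  have I_le: "ennreal (\<Sum>i\<in>I. ?d i) \<le> of_nat (vf \<gamma>) * ?V"
  proof -
    let ?x = "\<lambda>i. q (\<gamma> (s ! i))" and ?x' = "\<lambda>i. q (\<gamma> (s ! Suc i))"
    define xs where "xs = sorted_list_of_set (?x ` I \<union> ?x' ` I)"
    have xs: "sorted_wrt (<) xs" "set xs = ?x ` I \<union> ?x' ` I"
      using fin by (auto simp: xs_def)
    have xs_mem: "0 \<le> x \<and> rcis x \<theta> \<in> \<sigma> \<inter> ray \<theta>" if "x \<in> set xs" for x
      using that q mem unfolding xs(2) by (auto simp: I_def q_def)
    have cross: "card {i \<in> I. min (?x i) (?x' i) < y \<and> y < max (?x i) (?x' i)} \<le> vf \<gamma>"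
      (is "card ?C \<le> _") for y
    proof -
      let ?E = "entry_points \<gamma> {z. d \<bullet> z = y}"
      note ly = hyperplane_mem_lines[OF d, of y]
      note finE = finite_entry_points[OF \<gamma> ly]
      have "\<exists>e\<in>?E. s ! i < e \<and> e \<le> s ! Suc i" if "i \<in> ?C" for i
      proof -
        have i: "i < length s" "Suc i < length s" using that by (auto simp: I_def)
        have "s ! i < s ! Suc i" using i by (intro sorted_wrt_nth_less[OF s(1)]) auto
        \<comment> \<open>Clamping creates no new crossings: \<open>y\<close> exceeds a clamped
          coordinate, so \<open>y > 0\<close>, and positive values of \<open>q\<close> are
          unclamped.\<close>
        moreover have "min (d \<bullet> \<gamma> (s ! i)) (d \<bullet> \<gamma> (s ! Suc i)) < y \<and>
            y < max (d \<bullet> \<gamma> (s ! i)) (d \<bullet> \<gamma> (s ! Suc i))"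
          using that by (auto simp: q_def)
        ultimately show ?thesis
          using s01[OF i(1)] s01[OF i(2)] by (intro entry_point_hyperplane_between[OF path d]) auto
      qed
      then have "card ?C \<le> card {e \<in> ?E. s ! 0 < e}"
        by (intro card_steps_le_card_between[OF finE s(1)]) (auto simp: I_def)
      also have "\<dots> \<le> card ?E" using finE by (intro card_mono) auto
      also have "\<dots> \<le> vf \<gamma>" by (rule card_entry_points_le_vf[OF \<gamma> ly])
      finally show ?thesis .
    qed
    let ?h = "\<lambda>x. g (rcis x \<theta>)"
    let ?v = "\<Sum>j<length xs - 1. cmod (?h (xs ! Suc j) - ?h (xs ! j))"
    have "(\<Sum>i\<in>I. ?d i) = (\<Sum>i\<in>I. cmod (?h (?x' i) - ?h (?x i)))"
      using q mem by (intro sum.cong) (auto simp: I_def)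
    also have "\<dots> \<le> real (vf \<gamma>) * ?v"
      using xs cross fin by (intro sum_steps_le_mult_variation) auto
    finally have "ennreal (\<Sum>i\<in>I. ?d i) \<le> ennreal (real (vf \<gamma>) * ?v)" by (rule ennreal_leI)
    also have "\<dots> = of_nat (vf \<gamma>) * ennreal ?v"
      by (simp add: ennreal_mult sum_nonneg ennreal_of_nat_eq_real_of_nat)
    also have "\<dots> \<le> of_nat (vf \<gamma>) * ?V"
      using variation_on_ray_le_var[OF xs(1) xs_mem] by (intro mult_left_mono) auto
    finally show ?thesis .
  qed

  have gS: "ennreal (cmod (g z)) \<le> ?S" if "z \<in> \<sigma>" for z
    using that g[of z] by (cases "z \<in> ray \<theta>") (auto intro: SUP_upper)
  have "ennreal (\<Sum>i\<in>J. ?d i) = (\<Sum>i\<in>J. ennreal (?d i))" by simp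
  also have "\<dots> \<le> (\<Sum>i\<in>J. ?S)"
  proof (rule sum_mono)
    fix i assume i: "i \<in> J"
    \<comment> \<open>One end lies off \<open>L\<close>, so such a step costs \<open>?S\<close>
      rather than \<open>2 * ?S\<close>.\<close>
    then have "g (\<gamma> (s ! i)) = 0 \<or> g (\<gamma> (s ! Suc i)) = 0" using ray_L g by (auto simp: J_def)
    moreover have "\<gamma> (s ! i) \<in> \<sigma>" "\<gamma> (s ! Suc i) \<in> \<sigma>" using i mem by (auto simp: J_def)
    ultimately show "ennreal (?d i) \<le> ?S" using gS by auto
  qed
  also have "\<dots> = of_nat (card J) * ?S" by simp
  also have "\<dots> \<le> of_nat (2 * vf \<gamma>) * ?S"
    using card_line_transitions_le[OF \<gamma> L s(1,2)] by (intro mult_right_mono of_nat_mono) (auto simp: J_def)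
  also have "\<dots> = of_nat (vf \<gamma>) * (2 * ?S)" by (simp add: mult_ac)
  finally show ?thesis using I_le unfolding split by (simp add: distrib_left add_mono)
qed

section \<open>Bounding the spoke norm by the norm of \<open>f\<close>\<close>

text \<open>On the ray the spoke part differs from \<open>f\<close> by a constant, so the variation
  does not grow. Subtracting \<open>f 0\<close> at most doubles the supremum, since 0 belongs to
  \<open>\<sigma>\<close>.\<close>

lemma bv_norm_spoke_part_le:
  assumes "0 \<in> \<sigma>"
  shows "bv_norm (\<sigma> \<inter> ray \<theta>) (spoke_part \<theta> f) \<le> 2 * bv_norm \<sigma> f"
proof -
  let ?S = "SUP z\<in>\<sigma>. ennreal (cmod (f z))"
  have sup: "(SUP z\<in>\<sigma> \<inter> ray \<theta>. ennreal (cmod (spoke_part \<theta> f z))) \<le> 2 * ?S"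
  proof (rule SUP_least)
    fix z assume z: "z \<in> \<sigma> \<inter> ray \<theta>"
    have "ennreal (cmod (spoke_part \<theta> f z)) \<le> ennreal (cmod (f z) + cmod (f 0))"
      using z by (intro ennreal_leI) (simp add: spoke_part_def norm_triangle_ineq4)
    also have "\<dots> = ennreal (cmod (f z)) + ennreal (cmod (f 0))" by simp
    also have "\<dots> \<le> ?S + ?S" using z assms by (intro add_mono SUP_upper) auto
    finally show "ennreal (cmod (spoke_part \<theta> f z)) \<le> 2 * ?S" by (simp add: mult_2)
  qed
  have "var (\<sigma> \<inter> ray \<theta>) (spoke_part \<theta> f) \<le> var \<sigma> f"
    unfolding var_def
  proof (rule SUP_mono, rule bexI)
    fix \<gamma>
    have "cvar (\<sigma> \<inter> ray \<theta>) (spoke_part \<theta> f) \<gamma> \<le> cvar \<sigma> f \<gamma>"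
      unfolding cvar_def
    proof (rule SUP_mono, rule bexI)
      fix s assume s: "s \<in> {s. sorted_wrt (<) s \<and> set s \<subseteq> {0..1} \<and> \<gamma> ` set s \<subseteq> \<sigma> \<inter> ray \<theta>}"
      then have "\<gamma> (s ! i) \<in> ray \<theta>" if "i < length s" for i using that by auto
      then show "ennreal (\<Sum>i<length s - 1.
            cmod (spoke_part \<theta> f (\<gamma> (s ! Suc i)) - spoke_part \<theta> f (\<gamma> (s ! i))))
          \<le> ennreal (\<Sum>i<length s - 1. cmod (f (\<gamma> (s ! Suc i)) - f (\<gamma> (s ! i))))"
        by (intro ennreal_leI sum_mono) (simp add: spoke_part_def)
      show "s \<in> {s. sorted_wrt (<) s \<and> set s \<subseteq> {0..1} \<and> \<gamma> ` set s \<subseteq> \<sigma>}" using s by auto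
    qed
    then show "cvar (\<sigma> \<inter> ray \<theta>) (spoke_part \<theta> f) \<gamma> * ennreal (rho \<gamma>) \<le> cvar \<sigma> f \<gamma> * ennreal (rho \<gamma>)"
      by (rule mult_right_mono) simp
  qed
  also have "var \<sigma> f \<le> 2 * var \<sigma> f" by (simp add: mult_2)
  finally show ?thesis
    unfolding bv_norm_def distrib_left using sup by (intro add_mono)
qed

text \<open>The constant is 1 for the value at 0 plus 2 for each of the \<open>N\<close>
  spokes.\<close>

lemma spoke_norm_le:
  assumes "0 \<in> \<sigma>"
  shows "spoke_norm N \<theta> \<sigma> f \<le> ennreal (2 * real N + 1) * bv_norm \<sigma> f"
proof -
  have "ennreal (cmod (f 0)) \<le> (SUP z\<in>\<sigma>. ennreal (cmod (f z)))"
    using assms by (rule SUP_upper)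
  also have "\<dots> \<le> bv_norm \<sigma> f" unfolding bv_norm_def by simp
  finally have "ennreal (cmod (f 0)) \<le> bv_norm \<sigma> f" .
  moreover have "(\<Sum>n=1..N. bv_norm (\<sigma> \<inter> ray (\<theta> n)) (spoke_part (\<theta> n) f))
      \<le> (\<Sum>n=1..N. 2 * bv_norm \<sigma> f)"
    by (intro sum_mono bv_norm_spoke_part_le assms)
  ultimately have "spoke_norm N \<theta> \<sigma> f \<le> bv_norm \<sigma> f + of_nat N * (2 * bv_norm \<sigma> f)"
    unfolding spoke_norm_def by (simp add: add_mono)
  also have "\<dots> = of_nat (2 * N + 1) * bv_norm \<sigma> f"
    by (simp add: distrib_left distrib_right mult_ac)
  also have "of_nat (2 * N + 1) = ennreal (2 * real N + 1)"
    by (simp only: ennreal_of_nat_eq_real_of_nat) simp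
  finally show ?thesis .
qed

section \<open>Decomposition into spokes and the upper bound\<close>

text \<open>Distinct angles put a nonzero point on exactly one spoke, so only one term can survive;
  at 0 every term vanishes.\<close>

lemma spoke_decomposition:
  fixes N :: nat
  assumes "\<And>n. n \<in> {1..N} \<Longrightarrow> \<theta> n \<in> {0..<2 * pi}" "inj_on \<theta> {1..N}"
    and "z \<in> (\<Union>n\<in>{1..N}. ray (\<theta> n))"
  shows "f z = f 0 + (\<Sum>n=1..N. spoke_part (\<theta> n) f z)"
proof (cases "z = 0")
  case True
  have "spoke_part (\<theta> n) f 0 = 0" for n by (simp add: spoke_part_def)
  then show ?thesis using True by simp
next
  case False
  obtain m where m: "m \<in> {1..N}" "z \<in> ray (\<theta> m)" using assms(3) by blast
  have "spoke_part (\<theta> n) f z = (if n = m then f z - f 0 else 0)" if "n \<in> {1..N}" for n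
  proof (cases "n = m")
    case False
    then have "\<theta> n \<noteq> \<theta> m" using inj_onD[OF assms(2) _ that m(1)] by blast
    then have "z \<notin> ray (\<theta> n)"
      using ray_angle_unique[OF \<open>z \<noteq> 0\<close> _ m(2) assms(1)[OF that] assms(1)[OF m(1)]] by blast
    then show ?thesis using False by (simp add: spoke_part_def)
  qed (simp add: spoke_part_def m(2))
  then have "(\<Sum>n=1..N. spoke_part (\<theta> n) f z) = (\<Sum>n=1..N. if n = m then f z - f 0 else 0)"
    by (rule sum.cong[OF refl])
  then show ?thesis using m(1) by simp
qed

text \<open>The constant 3 arises because each spoke's supremum enters once through the supremum of
  \<open>f\<close> and twice through the single-spoke variation bound.\<close>

lemma bv_norm_le:
  assumes "0 \<in> \<sigma>"
    and "\<And>n. n \<in> {1..N} \<Longrightarrow> \<theta> n \<in> {0..<2 * pi}" "inj_on \<theta> {1..N}"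
    and "\<sigma> \<subseteq> (\<Union>n\<in>{1..N}. ray (\<theta> n))"
  shows "bv_norm \<sigma> f \<le> 3 * spoke_norm N \<theta> \<sigma> f"
proof -
  let ?g = "\<lambda>n. spoke_part (\<theta> n) f"
  let ?S = "\<lambda>n. SUP z\<in>\<sigma> \<inter> ray (\<theta> n). ennreal (cmod (?g n z))"
  let ?V = "\<lambda>n. var (\<sigma> \<inter> ray (\<theta> n)) (?g n)"
  have dec: "f z = f 0 + (\<Sum>n=1..N. ?g n z)" if "z \<in> \<sigma>" for z
    using spoke_decomposition[OF assms(2,3)] assms(4) that by blast
  have sup: "(SUP z\<in>\<sigma>. ennreal (cmod (f z))) \<le> ennreal (cmod (f 0)) + (\<Sum>n=1..N. ?S n)"
  proof (rule SUP_least)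
    fix z assume z: "z \<in> \<sigma>"
    have "cmod (f z) \<le> cmod (f 0) + (\<Sum>n=1..N. cmod (?g n z))"
      using norm_triangle_ineq[of "f 0" "\<Sum>n=1..N. ?g n z"] norm_sum[of "\<lambda>n. ?g n z" "{1..N}"]
      unfolding dec[OF z, symmetric] by linarith
    then have "ennreal (cmod (f z)) \<le> ennreal (cmod (f 0) + (\<Sum>n=1..N. cmod (?g n z)))"
      by (rule ennreal_leI)
    also have "\<dots> = ennreal (cmod (f 0)) + (\<Sum>n=1..N. ennreal (cmod (?g n z)))"
      by (simp add: ennreal_plus sum_nonneg)
    also have "\<dots> \<le> ennreal (cmod (f 0)) + (\<Sum>n=1..N. ?S n)"
    proof (intro add_left_mono sum_mono)
      fix n
      show "ennreal (cmod (?g n z)) \<le> ?S n"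
      proof (cases "z \<in> ray (\<theta> n)")
        case True
        then show ?thesis using z by (intro SUP_upper) auto
      qed (simp add: spoke_part_def[of _ _ z])
    qed
    finally show "ennreal (cmod (f z)) \<le> ennreal (cmod (f 0)) + (\<Sum>n=1..N. ?S n)" .
  qed
  define W where "W = (\<Sum>n=1..N. ?V n + 2 * ?S n)"
  have "cvar \<sigma> f \<gamma> * ennreal (rho \<gamma>) \<le> W" if \<gamma>: "pl_curve \<gamma>" for \<gamma>
  proof -
    have "cvar \<sigma> f \<gamma> \<le> of_nat (vf \<gamma>) * W"
      unfolding cvar_def
    proof (rule SUP_least, clarsimp)
      fix s assume s: "sorted_wrt (<) s" "set s \<subseteq> {0..1}" "\<gamma> ` set s \<subseteq> \<sigma>"
      let ?d = "\<lambda>g i. cmod (g (\<gamma> (s ! Suc i)) - g (\<gamma> (s ! i)))"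
      have "?d f i \<le> (\<Sum>n=1..N. ?d (?g n) i)" if "i < length s - 1" for i
      proof -
        have "\<gamma> (s ! Suc i) \<in> \<sigma>" "\<gamma> (s ! i) \<in> \<sigma>" using s(3) that by auto
        \<comment> \<open>The constant \<open>f 0\<close> cancels, so increments split over the
          spoke parts alone.\<close>
        then have "f (\<gamma> (s ! Suc i)) - f (\<gamma> (s ! i))
            = (\<Sum>n=1..N. ?g n (\<gamma> (s ! Suc i)) - ?g n (\<gamma> (s ! i)))"
          unfolding sum_subtractf using dec by (metis add_diff_cancel_left)
        then show ?thesis by (simp add: norm_sum)
      qed
      then have "(\<Sum>i<length s - 1. ?d f i) \<le> (\<Sum>i<length s - 1. \<Sum>n=1..N. ?d (?g n) i)"
        by (intro sum_mono) auto
      also have "\<dots> = (\<Sum>n=1..N. \<Sum>i<length s - 1. ?d (?g n) i)" by (rule sum.swap)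
      finally have "ennreal (\<Sum>i<length s - 1. ?d f i)
          \<le> ennreal (\<Sum>n=1..N. \<Sum>i<length s - 1. ?d (?g n) i)"
        by (rule ennreal_leI)
      also have "\<dots> = (\<Sum>n=1..N. ennreal (\<Sum>i<length s - 1. ?d (?g n) i))"
        by (intro sum_ennreal[symmetric] sum_nonneg) auto
      also have "\<dots> \<le> (\<Sum>n=1..N. of_nat (vf \<gamma>) * (?V n + 2 * ?S n))"
        using s by (intro sum_mono sum_steps_le_vf_mult \<gamma> assms(1)) (auto simp: spoke_part_def)
      also have "\<dots> = of_nat (vf \<gamma>) * W" by (simp add: W_def sum_distrib_left)
      finally show "ennreal (\<Sum>i<length s - Suc 0. ?d f i) \<le> of_nat (vf \<gamma>) * W" by simp
    qed
    then have "cvar \<sigma> f \<gamma> * ennreal (rho \<gamma>) \<le> of_nat (vf \<gamma>) * W * ennreal (rho \<gamma>)"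
      by (rule mult_right_mono) simp
    also have "\<dots> = ennreal (real (vf \<gamma>) * rho \<gamma>) * W"
      unfolding ennreal_of_nat_eq_real_of_nat
      by (subst ennreal_mult) (simp_all add: rho_def mult_ac)
    \<comment> \<open>The product \<open>real (vf \<gamma>) * rho \<gamma>\<close> is 1 if
      \<open>vf \<gamma>\<close> is positive and 0 otherwise, by the convention
      \<open>1 / 0 = 0\<close>.\<close>
    also have "\<dots> \<le> 1 * W"
      by (intro mult_right_mono) (auto simp: rho_def)
    finally show ?thesis by simp
  qed
  then have "var \<sigma> f \<le> W" unfolding var_def by (intro SUP_least) auto
  with sup have "bv_norm \<sigma> f \<le> ennreal (cmod (f 0)) + (\<Sum>n=1..N. ?S n) + W"
    unfolding bv_norm_def by (rule add_mono)
  also have "\<dots> = ennreal (cmod (f 0)) + (\<Sum>n=1..N. 3 * ?S n + ?V n)"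
  proof -
    have "3 * x = x + 2 * x" for x :: ennreal
      using distrib_right[of 1 2 x] by simp
    then show ?thesis by (simp add: W_def sum.distrib add_ac)
  qed
  also have "\<dots> \<le> 3 * ennreal (cmod (f 0)) + (\<Sum>n=1..N. 3 * ?S n + 3 * ?V n)"
  proof -
    have "x \<le> 3 * x" for x :: ennreal
      using mult_right_mono[of 1 3 x] by simp
    then show ?thesis by (intro add_mono sum_mono order_refl)
  qed
  also have "\<dots> = 3 * spoke_norm N \<theta> \<sigma> f"
    by (simp add: spoke_norm_def bv_norm_def distrib_left sum_distrib_left)
  finally show ?thesis .
qed

theorem proposition4p3:
  fixes \<sigma> :: "complex set" and N :: nat and \<theta> :: "nat \<Rightarrow> real" and f :: "complex \<Rightarrow> complex"
  assumes "compact \<sigma>" and "spoke_set \<sigma>" and "\<sigma> \<noteq> {}" and "0 \<in> \<sigma>"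
    and "\<And>n. n \<in> {1..N} \<Longrightarrow> \<theta> n \<in> {0..<2 * pi}"
    and "inj_on \<theta> {1..N}"
    and "\<sigma> \<subseteq> (\<Union>n\<in>{1..N}. ray (\<theta> n))"
    and "f \<in> BV \<sigma>"
  shows "ennreal (1 / (2 * real N + 1)) * spoke_norm N \<theta> \<sigma> f \<le> bv_norm \<sigma> f \<and>
         bv_norm \<sigma> f \<le> 3 * spoke_norm N \<theta> \<sigma> f"
proof
  have "ennreal (1 / (2 * real N + 1)) * spoke_norm N \<theta> \<sigma> f
      \<le> ennreal (1 / (2 * real N + 1)) * (ennreal (2 * real N + 1) * bv_norm \<sigma> f)"
    by (intro mult_left_mono spoke_norm_le assms) simp
  \<comment> \<open>The constants are merged as nonnegative reals, where the reciprocal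
    cancels.\<close>
  also have "\<dots> = ennreal (1 / (2 * real N + 1) * (2 * real N + 1)) * bv_norm \<sigma> f"
    by (subst ennreal_mult) (simp_all add: mult_ac)
  also have "1 / (2 * real N + 1) * (2 * real N + 1) = 1"
    by (simp add: add_nonneg_eq_0_iff)
  finally show "ennreal (1 / (2 * real N + 1)) * spoke_norm N \<theta> \<sigma> f \<le> bv_norm \<sigma> f" by simp
  show "bv_norm \<sigma> f \<le> 3 * spoke_norm N \<theta> \<sigma> f"
    by (rule bv_norm_le) (use assms in auto)
qed

end
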